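(* Let $d \geq 2$ be an integer and $\lambda \in \mathbb{C}$ with $\Im(\lambda) > 0$. Define a curve $h$ on $[0,\infty)$ by $h(t) = t\lambda$ for $t \in [0,1]$, and $h(t) = \frac{\lambda}{(1+h(t-1))^d}$ for $t > 1$. If $h(t)$ is defined and $\Im(h(t)) \geq 0$ for all $t \geq 0$, then $Z_G(\lambda) \neq 0$ for all graphs $G \in \mathcal{G}_{d+1}$.
   Context: For a finite graph $G$, $Z_G(\lambda) = \sum_{I} \lambda^{|I|}$, the sum over all independent sets $I$ of $G$ (including the empty set). $\mathcal{G}_{d+1}$ is the set of finite graphs with maximum degree at most $d+1$. *)

theory Defs
  imports Complex_Main "Graph_Theory.Digraph"
begin

text \<open>
  A finite simple undirected graph is the library's \<^locale>\<open>graph\<close>: a finite symmetric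
  digraph without loops or parallel arcs. Each undirected edge is a pair of opposite arcs,
  so the degree of a vertex is its out-degree.
\<close>

definition graphs_max_degree :: "nat \<Rightarrow> ('a, 'b) pre_digraph set" where
  "graphs_max_degree n = {G. Digraph.graph G \<and> (\<forall>v \<in> verts G. out_degree G v \<le> n)}"

definition independent_set :: "('a, 'b) pre_digraph \<Rightarrow> 'a set \<Rightarrow> bool" where
  "independent_set G I \<longleftrightarrow> I \<subseteq> verts G \<and> (\<forall>u \<in> I. \<forall>v \<in> I. (u, v) \<notin> arcs_ends G)"

definition independence_polynomial :: "('a, 'b) pre_digraph \<Rightarrow> complex \<Rightarrow> complex" where
  "independence_polynomial G lam = (\<Sum>I \<in> {I. independent_set G I}. lam ^ card I)"

text \<open>
  The curve is a partial function on the half-line of nonnegative times: the value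
  \<^const>\<open>None\<close> means ``undefined'', which happens for $t > 1$ if the value at $t - 1$ is
  undefined or makes the denominator vanish.
\<close>

function h_curve :: "nat \<Rightarrow> complex \<Rightarrow> real \<Rightarrow> complex option" where
  "h_curve d lam t =
     (if t < 0 then None
      else if t \<le> 1 then Some (complex_of_real t * lam)
      else (case h_curve d lam (t - 1) of
              None \<Rightarrow> None
            | Some w \<Rightarrow> if 1 + w = 0 then None else Some (lam / (1 + w) ^ d)))"
  by pat_completeness auto
termination
  by (relation "measure (\<lambda>(d, lam, t). nat \<lceil>t\<rceil>)") (auto simp: ceiling_diff_one)

declare h_curve.simps [simp del]

end

theory Submission
  imports Defs "HOL-Analysis.Complex_Transcendental"
begin

text \<open>
  Write \<open>exp w\<close> for the quotient of the polynomials of a graph and of the graph minus a vertex of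
  degree at most \<open>d\<close>. Deleting the neighbours one at a time shows that \<open>w = \<phi> v\<close> with
  \<open>\<phi> v = Ln (1 + lam * exp (- d * v))\<close> and \<open>v\<close> the average of \<open>d\<close> such logarithms (some of them 0),
  so it suffices to find a convex set \<open>K\<close> containing 0 with \<open>\<phi> ` K \<subseteq> K\<close> and
  \<open>0 \<le> d * Im v \<le> Arg lam\<close> on \<open>K\<close>.

  The curve \<open>z t = Ln (1 + h t)\<close> satisfies \<open>z (t + 1) = \<phi> (z t)\<close>. The argument of its velocity is
  an explicit decreasing function of the earlier heights \<open>Im (z (t - k))\<close>, so the curve turns to the
  right for as long as it climbs, and \<open>K\<close> is the part of the strip below its highest point that lies
  to the right of it. At a given height, further right means smaller argument of \<open>exp w - 1\<close>; as
  the argument of \<open>h\<close> decreases along the curve and \<open>\<phi>\<close> turns rightward rays into radial segments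
  of \<open>exp w - 1\<close>, the set \<open>K\<close> is invariant.
\<close>

section \<open>Preliminaries on real functions and triangles\<close>

text \<open>Subtracting a small slope from \<open>f\<close> leaves \<open>g\<close> with
  \<open>g a < g b\<close>. When \<open>g\<close> first reaches an intermediate level,
  \<open>f\<close> is at a record, so \<open>g\<close> has negative derivative and was above that
  level just before. Records matter past \<open>J\<close>, where the sign of the velocity is
  controlled only at such times.\<close>

lemma le_if_deriv_nonpos_at_records:
  fixes f :: "real \<Rightarrow> real"
  assumes "a \<le> b" and S: "finite S" and cont: "continuous_on {a..b} f"
    and deriv: "\<And>v. \<lbrakk>a < v; v < b; v \<notin> S; \<And>x. \<lbrakk>a \<le> x; x \<le> v\<rbrakk> \<Longrightarrow> f x \<le> f v\<rbrakk>
      \<Longrightarrow> \<exists>D\<le>0. (f has_real_derivative D) (at v)"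
  shows "f b \<le> f a"
proof (rule ccontr)
  assume "\<not> f b \<le> f a"
  then have gt: "f a < f b" by simp
  then have ab: "a < b" using \<open>a \<le> b\<close> by (cases "a = b") auto
  define e where "e = (f b - f a) / (2 * (b - a))"
  have e: "e > 0" using gt ab by (simp add: e_def)
  define g where "g x = f x - e * (x - a)" for x
  have "e * (b - a) = (f b - f a) / 2" using ab by (simp add: e_def field_simps)
  then have "g a < g b" using gt by (simp add: g_def)
  \<comment> \<open>A level outside the image of \<open>S\<close> keeps the first hitting time away
    from the exceptional points.\<close>
  then have "infinite {g a<..<g b}" by simp
  then obtain L where L: "L \<in> {g a<..<g b}" "L \<notin> g ` S"
    using S by (meson finite_imageI finite_subset subsetI)
  have contg: "continuous_on {a..b} g"
    unfolding g_def by (intro continuous_intros cont)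
  define H where "H = {x \<in> {a..b}. L \<le> g x}"
  have "closed H"
    unfolding H_def by (intro continuous_on_closed_Collect_le contg continuous_intros)
  have bH: "b \<in> H" using L ab by (auto simp: H_def)
  have bdd: "bdd_below H" by (auto simp: H_def intro: bdd_belowI[of _ a])
  define v where "v = Inf H"
  have vH: "v \<in> H"
    unfolding v_def using \<open>closed H\<close> bH bdd by (intro closed_contains_Inf) auto
  have before: "g x < L" if "a \<le> x" "x < v" for x
  proof (rule ccontr)
    assume "\<not> g x < L"
    then have "x \<in> H" using that vH by (auto simp: H_def)
    then show False using cInf_lower[OF _ bdd, of x] that by (simp add: v_def)
  qed
  have av: "a < v" using vH L by (cases "a = v") (auto simp: H_def)
  have "g v = L"
  proof (rule ccontr)
    assume "g v \<noteq> L"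
    then have "L < g v" using vH by (auto simp: H_def)
    moreover have "continuous_on {a..v} g"
      using contg by (rule continuous_on_subset) (use vH in \<open>auto simp: H_def\<close>)
    ultimately obtain x where x: "a \<le> x" "x \<le> v" "g x = L"
      using IVT'[of g a L v] L av by auto
    then show False using before[of x] \<open>g v \<noteq> L\<close> by (cases "x = v") auto
  qed
  have vb: "v < b" using vH L \<open>g v = L\<close> by (cases "v = b") (auto simp: H_def)
  have "v \<notin> S" using L \<open>g v = L\<close> by auto
  have f_le: "f x \<le> f v" if "a \<le> x" "x \<le> v" for x
  proof (cases "x = v")
    case False
    then have "g x < g v" using before[of x] that \<open>g v = L\<close> by simp
    moreover have "e * (x - a) \<le> e * (v - a)" using e that by simp
    ultimately show ?thesis by (simp add: g_def)
  qed simp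
  obtain D where D: "D \<le> 0" "(f has_real_derivative D) (at v)"
    using deriv[OF av vb \<open>v \<notin> S\<close> f_le] by auto
  have "(g has_real_derivative D - e) (at v)"
    unfolding g_def by (auto intro!: derivative_eq_intros D)
  moreover have "D - e < 0" using D e by simp
  ultimately obtain k where k: "k > 0" "\<And>h. \<lbrakk>0 < h; h < k\<rbrakk> \<Longrightarrow> g v < g (v - h)"
    using DERIV_neg_dec_left by blast
  define h where "h = min (k / 2) (v - a)"
  have h: "0 < h" "h < k" "h \<le> v - a" using k av by (auto simp: h_def)
  have "g (v - h) < L" using before h by simp
  with k(2)[OF h(1,2)] \<open>g v = L\<close> show False by simp
qed

section \<open>Triangles with vertices 0, 1 and \<open>1 + rcis r \<theta>\<close>\<close>

lemma one_plus_rcis_notin_nonpos_Reals: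
  assumes "0 \<le> r" "0 \<le> \<theta>" "\<theta> < pi"
  shows "1 + rcis r \<theta> \<notin> \<real>\<^sub>\<le>\<^sub>0"
proof
  assume "1 + rcis r \<theta> \<in> \<real>\<^sub>\<le>\<^sub>0"
  then have *: "r * sin \<theta> = 0" "1 + r * cos \<theta> \<le> 0"
    by (auto simp: complex_nonpos_Reals_iff)
  then have "r \<noteq> 0" by auto
  with * have "sin \<theta> = 0" by simp
  then have "\<theta> = 0" using assms sin_gt_zero[of \<theta>] by (cases "\<theta> = 0") auto
  then show False using * assms by simp
qed

text \<open>Law of sines in the triangle 0, 1, \<open>exp w\<close>: the angles at 0 and at
  \<open>exp w\<close> are \<open>Im w\<close> and \<open>\<theta> - Im w\<close>, opposite to the
  sides \<open>r\<close> and 1, and the side \<open>exp (Re w)\<close> is opposite to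
  \<open>pi - \<theta>\<close>.\<close>

lemma Ln_one_plus_rcis_sines:
  fixes r \<theta> :: real
  assumes "0 \<le> r" "0 \<le> \<theta>" "\<theta> < pi"
  defines "w \<equiv> Ln (1 + rcis r \<theta>)"
  shows "exp (Re w) * sin (\<theta> - Im w) = sin \<theta>" and "r * sin \<theta> = exp (Re w) * sin (Im w)"
    and "0 \<le> Im w" and "Im w < pi"
proof -
  have nz: "1 + rcis r \<theta> \<noteq> 0" and np: "1 + rcis r \<theta> \<notin> \<real>\<^sub>\<le>\<^sub>0"
    using one_plus_rcis_notin_nonpos_Reals[OF assms(1-3)] by auto
  have "exp w = 1 + rcis r \<theta>" unfolding w_def using nz by simp
  then have re: "exp (Re w) * cos (Im w) = 1 + r * cos \<theta>"
    and im: "exp (Re w) * sin (Im w) = r * sin \<theta>"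
    by (metis Re_exp Re_rcis plus_complex.sel(1) one_complex.sel(1),
        metis Im_exp Im_rcis plus_complex.sel(2) one_complex.sel(2) add_0)
  show "r * sin \<theta> = exp (Re w) * sin (Im w)" using im by simp
  have "exp (Re w) * sin (\<theta> - Im w)
      = sin \<theta> * (exp (Re w) * cos (Im w)) - cos \<theta> * (exp (Re w) * sin (Im w))"
    by (simp add: sin_diff algebra_simps)
  then show "exp (Re w) * sin (\<theta> - Im w) = sin \<theta>"
    unfolding re im by (simp add: algebra_simps)
  have "0 \<le> r * sin \<theta>" using assms sin_ge_zero[of \<theta>] by simp
  then show "0 \<le> Im w"
    unfolding w_def using Im_Ln_pos_le[OF nz] \<open>0 \<le> r * sin \<theta>\<close> by simp
  show "Im w < pi"
    unfolding w_def using nz np by (simp add: Im_Ln_less_pi)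
qed

lemma Im_Ln_one_plus_rcis_le:
  assumes "0 \<le> r" "0 \<le> \<theta>" "\<theta> < pi"
  shows "Im (Ln (1 + rcis r \<theta>)) \<le> \<theta>"
proof (rule ccontr)
  let ?w = "Ln (1 + rcis r \<theta>)"
  note sines = Ln_one_plus_rcis_sines[OF assms]
  assume "\<not> Im ?w \<le> \<theta>"
  then have "0 < sin (Im ?w - \<theta>)" using sines(4) assms by (intro sin_gt_zero) auto
  then have "sin (\<theta> - Im ?w) < 0" by (simp add: sin_diff mult.commute)
  then have "exp (Re ?w) * sin (\<theta> - Im ?w) < 0" by (simp add: mult_pos_neg)
  then show False using sines(1) sin_ge_zero[of \<theta>] assms by simp
qed

lemma sin_minus_Im_Ln_pos:
  assumes "0 \<le> r" "0 < \<theta>" "\<theta> < pi"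
  shows "0 < sin (\<theta> - Im (Ln (1 + rcis r \<theta>)))"
proof -
  have "0 < exp (Re (Ln (1 + rcis r \<theta>))) * sin (\<theta> - Im (Ln (1 + rcis r \<theta>)))"
    using Ln_one_plus_rcis_sines(1)[of r \<theta>] assms by (simp add: sin_gt_zero)
  then show ?thesis by (simp add: zero_less_mult_iff)
qed

lemma Im_Ln_one_plus_rcis_less:
  assumes "0 \<le> r" "0 < \<theta>" "\<theta> < pi"
  shows "Im (Ln (1 + rcis r \<theta>)) < \<theta>"
  using sin_minus_Im_Ln_pos[OF assms] Im_Ln_one_plus_rcis_le[of r \<theta>] assms
  by (cases "Im (Ln (1 + rcis r \<theta>)) = \<theta>") auto

text \<open>With \<open>u\<close> for the imaginary part, the law of sines gives
  \<open>r = sin u / sin (\<theta> - u)\<close>, a quotient that increases with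
  \<open>u\<close>.\<close>

lemma Im_Ln_one_plus_rcis_strict_mono:
  assumes "0 \<le> r" "r < r'" "0 < \<theta>" "\<theta> < pi"
  shows "Im (Ln (1 + rcis r \<theta>)) < Im (Ln (1 + rcis r' \<theta>))"
proof (rule ccontr)
  define u where "u = Im (Ln (1 + rcis r \<theta>))"
  define u' where "u' = Im (Ln (1 + rcis r' \<theta>))"
  have ratio: "s * sin (\<theta> - Im (Ln (1 + rcis s \<theta>))) = sin (Im (Ln (1 + rcis s \<theta>)))"
    if "0 \<le> s" for s
  proof -
    let ?w = "Ln (1 + rcis s \<theta>)"
    have "exp (Re ?w) * (s * sin (\<theta> - Im ?w)) = exp (Re ?w) * sin (Im ?w)"
      using Ln_one_plus_rcis_sines(1,2)[of s \<theta>] that assms by (simp add: algebra_simps)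
    then show ?thesis by simp
  qed
  have r: "r * sin (\<theta> - u) = sin u" and r': "r' * sin (\<theta> - u') = sin u'"
    using ratio[of r] ratio[of r'] assms by (auto simp: u_def u'_def)
  have pos: "0 < sin (\<theta> - u)" "0 < sin (\<theta> - u')"
    using sin_minus_Im_Ln_pos[of r \<theta>] sin_minus_Im_Ln_pos[of r' \<theta>] assms
    by (auto simp: u_def u'_def)
  assume "\<not> ?thesis"
  then have "u' \<le> u" by (simp add: u_def u'_def)
  moreover have "0 \<le> u'" "u < pi"
    using Ln_one_plus_rcis_sines(3)[of r' \<theta>] Ln_one_plus_rcis_sines(4)[of r \<theta>] assms
    by (auto simp: u_def u'_def)
  ultimately have "0 \<le> sin (u - u')" by (intro sin_ge_zero) auto
  then have "0 \<le> sin \<theta> * sin (u - u')" using assms by (simp add: sin_ge_zero)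
  also have "sin \<theta> * sin (u - u')
      = sin u * sin (\<theta> - u') - sin u' * sin (\<theta> - u)"
    using sin_cos_squared_add[of \<theta>]
    by (simp add: sin_diff algebra_simps)
  also have "\<dots> = (r - r') * (sin (\<theta> - u) * sin (\<theta> - u'))"
    unfolding r[symmetric] r'[symmetric] by (simp add: algebra_simps)
  also have "\<dots> < 0" using pos assms by (simp add: mult_neg_pos)
  finally show False by simp
qed

text \<open>At fixed height \<open>u\<close> the law of sines gives
  \<open>exp (Re w) = sin \<theta> / sin (\<theta> - u)\<close>, which is nonincreasing in
  \<open>\<theta>\<close>.\<close>

lemma Re_Ln_one_plus_rcis_le:
  assumes "0 \<le> r" "0 \<le> r'" "0 < \<theta>" "\<theta> \<le> \<theta>'" "\<theta>' < pi"
    and eq: "Im (Ln (1 + rcis r \<theta>)) = Im (Ln (1 + rcis r' \<theta>'))"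
  shows "Re (Ln (1 + rcis r' \<theta>')) \<le> Re (Ln (1 + rcis r \<theta>))"
proof -
  define w where "w = Ln (1 + rcis r \<theta>)"
  define w' where "w' = Ln (1 + rcis r' \<theta>')"
  define u where "u = Im w"
  have 1: "exp (Re w) * sin (\<theta> - u) = sin \<theta>" "exp (Re w') * sin (\<theta>' - u) = sin \<theta>'"
    using Ln_one_plus_rcis_sines(1)[of r \<theta>] Ln_one_plus_rcis_sines(1)[of r' \<theta>'] assms
    by (auto simp: w_def w'_def u_def)
  have pos: "0 < sin (\<theta> - u)" "0 < sin (\<theta>' - u)"
    using sin_minus_Im_Ln_pos[of r \<theta>] sin_minus_Im_Ln_pos[of r' \<theta>'] assms
    by (auto simp: w_def w'_def u_def)
  have "0 \<le> u" "u < pi"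
    using Ln_one_plus_rcis_sines(3,4)[of r \<theta>] assms by (auto simp: u_def w_def)
  then have "0 \<le> sin u * sin (\<theta>' - \<theta>)"
    using assms by (intro mult_nonneg_nonneg sin_ge_zero) auto
  also have "\<dots> = sin \<theta> * sin (\<theta>' - u) - sin \<theta>' * sin (\<theta> - u)"
    by (simp add: sin_diff algebra_simps)
  also have "\<dots> = (exp (Re w) - exp (Re w')) * (sin (\<theta> - u) * sin (\<theta>' - u))"
    unfolding 1[symmetric] by (simp add: algebra_simps)
  finally have "exp (Re w') \<le> exp (Re w)"
    using mult_pos_pos[OF pos] by (auto simp: zero_le_mult_iff)
  then show ?thesis by (simp add: w_def w'_def)
qed

section \<open>The curve in logarithmic coordinates\<close>

locale upper_h_curve =
  fixes d :: nat and lam :: complex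
  assumes d_pos: "0 < d" and Im_lam: "0 < Im lam"
    and h_upper: "\<And>t::real. 0 \<le> t \<Longrightarrow> \<exists>w. h_curve d lam t = Some w \<and> 0 \<le> Im w"
begin

text \<open>The value 0 at negative times makes \<open>z\<close> vanish there, so formulas that look
  back beyond time 0 need no case distinction.\<close>

definition h :: "real \<Rightarrow> complex" where
  "h t = (if t < 0 then 0 else the (h_curve d lam t))"

definition z :: "real \<Rightarrow> complex" where
  "z t = Ln (1 + h t)"

abbreviation y :: "real \<Rightarrow> real" where
  "y t \<equiv> Im (z t)"

abbreviation a0 :: real where
  "a0 \<equiv> Arg lam"

text \<open>An argument of \<open>h t\<close> for all \<open>0 \<le> t\<close>; on the first unit
  interval it is the constant \<open>a0\<close>.\<close>

definition \<theta> :: "real \<Rightarrow> real" where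
  "\<theta> t = a0 - d * y (t - 1)"

lemma a0: "0 < a0" "a0 < pi"
  using Im_lam Arg_lt_pi[of lam] by auto

lemma lam_nz: "lam \<noteq> 0"
  using Im_lam by auto

lemma h_unit: "t \<le> 1 \<Longrightarrow> h t = of_real (max 0 t) * lam"
  by (auto simp: h_def h_curve.simps[of d lam t])

lemma h_step:
  assumes "0 \<le> t"
  shows "1 + h t \<noteq> 0" and "h (t + 1) = lam / (1 + h t) ^ d"
proof -
  have *: "1 + h t \<noteq> 0 \<and> h (t + 1) = lam / (1 + h t) ^ d"
  proof (cases "t = 0")
    case True
    then show ?thesis using h_unit[of 0] h_unit[of 1] by simp
  next
    case False
    with assms h_upper[of "t + 1"] show ?thesis
      by (auto simp: h_def h_curve.simps[of d lam "t + 1"] split: option.splits if_splits)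
  qed
  show "1 + h t \<noteq> 0" "h (t + 1) = lam / (1 + h t) ^ d" using * by auto
qed

lemma Im_h: "0 \<le> Im (h t)"
  using h_upper[of t] by (auto simp: h_def)

lemma one_plus_h_nz: "1 + h t \<noteq> 0"
  using h_step(1)[of t] h_unit[of t] by (cases "t < 0") auto

lemma exp_z: "exp (z t) = 1 + h t"
  unfolding z_def using one_plus_h_nz by simp

lemma z_neg: "t \<le> 0 \<Longrightarrow> z t = 0"
  by (simp add: z_def h_unit)

lemma y_nonneg: "0 \<le> y t"
  using Im_Ln_pos_le[OF one_plus_h_nz[of t]] Im_h[of t] by (simp add: z_def)

lemma h_step_exp: "0 \<le> t \<Longrightarrow> h (t + 1) = lam * exp (- (of_nat d * z t))"
  by (simp add: h_step exp_minus exp_of_nat_mult exp_z divide_inverse)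

lemma lam_exp_rcis:
  "lam * exp (- (of_nat d * w)) = rcis (cmod lam * exp (- (d * Re w))) (a0 - d * Im w)"
proof -
  have "lam = rcis (cmod lam) a0" by (simp add: rcis_cmod_Arg)
  moreover have "exp (- (of_nat d * w)) = rcis (exp (- (d * Re w))) (- (d * Im w))"
    by (simp add: exp_eq_polar rcis_def)
  ultimately show ?thesis by (metis rcis_mult add_uminus_conv_diff)
qed

lemma lam_exp_notin_nonpos_Reals:
  assumes "0 \<le> Im w" "d * Im w \<le> a0"
  shows "1 + lam * exp (- (of_nat d * w)) \<notin> \<real>\<^sub>\<le>\<^sub>0"
proof -
  have "0 \<le> d * Im w" using assms by simp
  then show ?thesis unfolding lam_exp_rcis using assms a0
    by (intro one_plus_rcis_notin_nonpos_Reals) (simp, linarith+)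
qed

lemma h_step_rcis: "0 \<le> t \<Longrightarrow> h (t + 1) = rcis (cmod (h (t + 1))) (a0 - d * y t)"
  using h_step_exp[of t] lam_exp_rcis[of "z t"] by (simp add: abs_mult)

lemma h_rcis:
  assumes "0 \<le> t"
  shows "h t = rcis (cmod (h t)) (\<theta> t)"
proof (cases "t < 1")
  case True
  then have *: "h t = of_real t * lam" using assms by (simp add: h_unit)
  have "y (t - 1) = 0" using True by (simp add: z_neg)
  then have "rcis (cmod (h t)) (\<theta> t) = of_real t * rcis (cmod lam) a0"
    using assms by (simp add: * \<theta>_def norm_mult rcis_def mult.assoc)
  then show ?thesis by (simp add: * rcis_cmod_Arg)
next
  case False
  then show ?thesis using h_step_rcis[of "t - 1"] by (simp add: \<theta>_def)
qed

text \<open>Otherwise \<open>d * y\<close> would pass a value less than \<open>pi\<close> above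
  \<open>a0\<close>, and one unit later \<open>h\<close> would lie in the open lower half-plane.
  Continuity is assumed only up to time \<open>n\<close> because the next interval inherits it
  through this bound.\<close>

lemma y_le_if_continuous:
  assumes cont: "continuous_on {..real n} z" and "t \<le> real n"
  shows "d * y t \<le> a0"
proof (rule ccontr)
  assume *: "\<not> d * y t \<le> a0"
  then have "0 < t" using z_neg[of t] a0 by (cases "0 < t") auto
  \<comment> \<open>The cap keeps \<open>a0 - m\<close> strictly between \<open>- pi\<close> and 0,
    where the sine is negative.\<close>
  define m where "m = min (d * y t) (a0 + pi / 2)"
  have m: "a0 < m" "m < a0 + pi" "m \<le> d * y t" using * pi_gt_zero by (auto simp: m_def min_def simp del: pi_gt_zero)
  have "continuous_on {0..t} (\<lambda>s. d * y s)"
    by (intro continuous_intros continuous_on_subset[OF cont]) (use assms in auto)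
  moreover have "d * y 0 = 0" by (simp add: z_neg)
  ultimately obtain s where s: "0 \<le> s" "s \<le> t" "d * y s = m"
    using IVT'[of "\<lambda>s. d * y s" 0 m t] m a0 \<open>0 < t\<close> by auto
  have "h (s + 1) \<noteq> 0" using h_step_exp[OF s(1)] lam_nz by simp
  moreover have "sin (a0 - m) < 0"
    using sin_gt_zero[of "m - a0"] m by (simp add: sin_diff algebra_simps)
  ultimately have "cmod (h (s + 1)) * sin (a0 - m) < 0" by (simp add: mult_pos_neg)
  moreover have "Im (h (s + 1)) = cmod (h (s + 1)) * sin (a0 - m)"
    using arg_cong[OF h_step_rcis[OF s(1)], of Im] s(3) by simp
  ultimately show False using Im_h[of "s + 1"] by simp
qed

text \<open>Each unit piece is the image of the preceding one, whose height bound keeps the argument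
  of \<open>Ln\<close> off the branch cut.\<close>

lemma z_continuous_on_atMost: "continuous_on {..real (Suc n)} z"
proof (induction n)
  case 0
  have "1 + of_real (max 0 t) * lam \<notin> \<real>\<^sub>\<le>\<^sub>0" for t
    using Im_lam by (cases "0 < t") (auto simp: complex_nonpos_Reals_iff)
  then have "continuous_on {..1} (\<lambda>t. Ln (1 + of_real (max 0 t) * lam))"
    by (intro continuous_intros) auto
  then have "continuous_on {..1} z"
    by (rule continuous_on_eq) (auto simp: z_def h_unit)
  then show ?case by simp
next
  case (Suc n)
  have step: "z t = Ln (1 + lam * exp (- (of_nat d * z (t - 1))))" if "1 \<le> t" for t
    using h_step_exp[of "t - 1"] that by (simp add: z_def)
  have "continuous_on {1..real (Suc (Suc n))} (\<lambda>t. z (t - 1))"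
    by (rule continuous_on_compose2[OF Suc.IH]) (auto intro!: continuous_intros)
  then have "continuous_on {1..real (Suc (Suc n))}
      (\<lambda>t. Ln (1 + lam * exp (- (of_nat d * z (t - 1)))))"
    by (intro continuous_intros lam_exp_notin_nonpos_Reals y_nonneg
        y_le_if_continuous[OF Suc.IH]) auto
  then have "continuous_on {1..real (Suc (Suc n))} z"
    by (rule continuous_on_eq) (simp add: step)
  then have "continuous_on ({..real (Suc n)} \<union> {1..real (Suc (Suc n))}) z"
    by (intro continuous_on_closed_Un Suc.IH) auto
  moreover have "{..real (Suc n)} \<union> {1..real (Suc (Suc n))} = {..real (Suc (Suc n))}"
    by auto
  ultimately show ?case by simp
qed

lemma y_le: "d * y t \<le> a0"
proof -
  obtain n where "t \<le> real n" using real_arch_simple by blast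
  then show ?thesis
    using y_le_if_continuous[OF z_continuous_on_atMost[of n], of t] by simp
qed

lemma continuous_on_z: "continuous_on A z"
proof (rule continuous_at_imp_continuous_on, rule ballI)
  fix t
  obtain n where "t < real n" using reals_Archimedean2 by blast
  then have "t \<in> interior {..real (Suc n)}"
    by (intro interiorI[of "{..<real n}"]) auto
  then show "isCont z t"
    using z_continuous_on_atMost continuous_on_interior by blast
qed

lemma \<theta>_bounds: "0 \<le> \<theta> t" "\<theta> t \<le> a0" "\<theta> t < pi"
proof -
  have "0 \<le> d * y (t - 1)" using y_nonneg by simp
  then show "0 \<le> \<theta> t" "\<theta> t \<le> a0" "\<theta> t < pi"
    using y_le[of "t - 1"] a0 unfolding \<theta>_def by linarith+
qed

lemma y_le_\<theta>: "0 \<le> t \<Longrightarrow> y t \<le> \<theta> t"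
  using Im_Ln_one_plus_rcis_le[of "cmod (h t)" "\<theta> t"] h_rcis[of t] \<theta>_bounds[of t]
  by (simp add: z_def)

text \<open>The argument of the velocity \<open>z'(t)\<close>: passing from \<open>t\<close> to \<open>t + 1\<close> multiplies the
  velocity by \<open>- d * h (t + 1) / (1 + h (t + 1))\<close>. Since \<open>y\<close> vanishes on the negative axis,
  every summand is nondecreasing as long as \<open>y\<close> is.\<close>

definition \<alpha> :: "real \<Rightarrow> real" where
  "\<alpha> t = a0 - of_int \<lfloor>t\<rfloor> * (pi - a0) - y t
     - (d + 1) * (\<Sum>k = 1..nat \<lfloor>t\<rfloor>. y (t - real k))"

lemma \<alpha>_unit: "\<lbrakk>0 \<le> t; t < 1\<rbrakk> \<Longrightarrow> \<alpha> t = a0 - y t"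
  by (simp add: \<alpha>_def floor_eq_iff[of t 0, THEN iffD2])

lemma \<alpha>_step:
  assumes "0 \<le> t"
  shows "\<alpha> (t + 1) = \<alpha> t + a0 - pi - d * y t - y (t + 1)"
proof -
  have "nat \<lfloor>t + 1\<rfloor> = Suc (nat \<lfloor>t\<rfloor>)" using assms by (simp add: nat_add_distrib)
  moreover have "(\<Sum>k = 1..Suc m. y (t + 1 - real k)) = y t + (\<Sum>k = 1..m. y (t - real k))" for m
  proof -
    have "(\<Sum>k = 1..Suc m. y (t + 1 - real k)) = (\<Sum>k = 0..m. y (t - real k))"
      by (simp add: sum.atLeast_Suc_atMost_Suc_shift del: sum.cl_ivl_Suc)
    then show ?thesis by (simp add: sum.atLeast_Suc_atMost)
  qed
  ultimately show ?thesis by (simp add: \<alpha>_def algebra_simps)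
qed

text \<open>Comparing heights pointwise lets this serve both on \<open>J\<close> and at record times
  after it. The additional summands at the later time only lower \<open>\<alpha>\<close>, as heights
  are nonnegative.\<close>

lemma \<alpha>_antimono:
  assumes "s \<le> t" "y s \<le> y t" "\<And>k. 1 \<le> k \<Longrightarrow> y (s - real k) \<le> y (t - real k)"
  shows "\<alpha> t \<le> \<alpha> s"
proof -
  have fl: "\<lfloor>s\<rfloor> \<le> \<lfloor>t\<rfloor>" using assms by (simp add: floor_mono)
  have "(\<Sum>k = 1..nat \<lfloor>s\<rfloor>. y (s - real k)) \<le> (\<Sum>k = 1..nat \<lfloor>s\<rfloor>. y (t - real k))"
    using assms by (intro sum_mono) auto
  also have "\<dots> \<le> (\<Sum>k = 1..nat \<lfloor>t\<rfloor>. y (t - real k))"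
    using fl by (intro sum_mono2) (auto simp: y_nonneg)
  finally have "(d + 1) * (\<Sum>k = 1..nat \<lfloor>s\<rfloor>. y (s - real k))
      \<le> (d + 1) * (\<Sum>k = 1..nat \<lfloor>t\<rfloor>. y (t - real k))"
    by (intro mult_left_mono) auto
  moreover have "of_int \<lfloor>s\<rfloor> * (pi - a0) \<le> of_int \<lfloor>t\<rfloor> * (pi - a0)"
    using fl a0 by (intro mult_right_mono) auto
  ultimately show ?thesis using assms(2) unfolding \<alpha>_def by linarith
qed

lemma \<alpha>_le: "0 \<le> t \<Longrightarrow> \<alpha> t \<le> a0"
proof -
  assume "0 \<le> t"
  have "0 \<le> of_int \<lfloor>t\<rfloor> * (pi - a0)" using a0 \<open>0 \<le> t\<close> by simp
  moreover have "0 \<le> (d + 1) * (\<Sum>k = 1..nat \<lfloor>t\<rfloor>. y (t - real k))"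
    by (intro mult_nonneg_nonneg sum_nonneg y_nonneg) auto
  ultimately show ?thesis using y_nonneg[of t] unfolding \<alpha>_def by linarith
qed

text \<open>Chain rule, by induction over unit intervals. At integers the pieces may meet with
  different velocities. Only the direction is used later, so the speed \<open>r\<close> is
  existential.\<close>

lemma z_has_vector_derivative:
  assumes "0 < t" "t \<notin> \<int>"
  shows "\<exists>r\<ge>0. (z has_vector_derivative rcis r (\<alpha> t)) (at t)"
proof -
  have "\<exists>r\<ge>0. (z has_vector_derivative rcis r (\<alpha> t)) (at t)"
    if "real n < t" "t < real n + 1" for n
    using that
  proof (induction n arbitrary: t)
    case 0
    have "1 + of_real t * lam \<notin> \<real>\<^sub>\<le>\<^sub>0"
      using Im_lam 0 by (auto simp: complex_nonpos_Reals_iff)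
    then have "((\<lambda>t. Ln (1 + of_real t * lam)) has_vector_derivative lam / (1 + of_real t * lam)) (at t)"
      by (auto intro!: derivative_eq_intros has_vector_derivative_real_field simp: field_simps)
    then have "(z has_vector_derivative lam / (1 + of_real t * lam)) (at t)"
      by (rule has_vector_derivative_transform_within_open[of _ _ _ "{0<..<1}"])
        (use 0 in \<open>auto simp: z_def h_unit\<close>)
    moreover have "lam / (1 + of_real t * lam) = rcis (cmod lam / exp (Re (z t))) (\<alpha> t)"
    proof -
      have "1 + of_real t * lam = rcis (exp (Re (z t))) (y t)"
        using exp_z[of t] 0 by (simp add: h_unit exp_eq_polar rcis_def)
      moreover have "lam = rcis (cmod lam) a0" by (simp add: rcis_cmod_Arg)
      ultimately show ?thesis using 0 by (metis \<alpha>_unit rcis_divide less_eq_real_def of_nat_0 add_0)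
    qed
    ultimately show ?case by (metis divide_nonneg_pos norm_ge_zero exp_gt_zero)
  next
    case (Suc n)
    define s where "s = t - 1"
    have t: "t = s + 1" by (simp add: s_def)
    have s: "real n < s" "s < real n + 1" "0 \<le> s" using Suc.prems by (auto simp: s_def)
    obtain r where r: "r \<ge> 0" "(z has_vector_derivative rcis r (\<alpha> s)) (at s)"
      using Suc.IH[OF s(1,2)] by auto
    have shift: "((\<lambda>t. z (t - 1)) has_vector_derivative rcis r (\<alpha> s)) (at t)"
    proof -
      have "((z \<circ> (\<lambda>t. t - 1)) has_vector_derivative 1 *\<^sub>R rcis r (\<alpha> s)) (at t)"
        by (rule vector_diff_chain_at)
          (use r in \<open>auto intro!: derivative_eq_intros simp: s_def\<close>)
      then show ?thesis by (simp add: o_def)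
    qed
    have np: "1 + lam * exp (- (of_nat d * z s)) \<notin> \<real>\<^sub>\<le>\<^sub>0"
      by (intro lam_exp_notin_nonpos_Reals y_nonneg y_le)
    have hs: "h t = lam * exp (- (of_nat d * z s))" using h_step_exp[OF s(3)] t by simp
    have "((\<lambda>w. Ln (1 + lam * exp (- (of_nat d * w)))) has_field_derivative
        - of_nat d * h t / (1 + h t)) (at (z (t - 1)))"
      unfolding s_def[symmetric]
      by ((rule derivative_eq_intros refl np | simp add: hs)+) (simp add: divide_inverse mult_ac)
    from field_vector_diff_chain_at[OF shift this]
    have "((\<lambda>t. Ln (1 + lam * exp (- (of_nat d * z (t - 1))))) has_vector_derivative
        rcis r (\<alpha> s) * (- of_nat d * h t / (1 + h t))) (at t)"
      by (simp add: o_def)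
    then have "(z has_vector_derivative rcis r (\<alpha> s) * (- of_nat d * h t / (1 + h t))) (at t)"
      by (rule has_vector_derivative_transform_within_open[of _ _ _ "{1<..}"])
        (use Suc.prems h_step_exp[of "_ - 1"] in \<open>auto simp: z_def\<close>)
    moreover have "rcis r (\<alpha> s) * (- of_nat d * h t / (1 + h t))
        = rcis (r * (d * cmod (h t) / exp (Re (z t)))) (\<alpha> t)"
    proof -
      have "1 + h t = rcis (exp (Re (z t))) (y t)"
        using exp_z[of t] by (simp add: exp_eq_polar rcis_def)
      moreover have "- of_nat d * h t = rcis (real d * cmod (h t)) (a0 - d * y s - pi)"
      proof -
        \<comment> \<open>The argument of -1 is taken as \<open>- pi\<close> rather than
          \<open>pi\<close>, the branch built into \<open>\<alpha>\<close> that makes it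
          decrease.\<close>
        have "- of_nat d = rcis (real d) (- pi)" by (simp add: rcis_def cis_conv_exp exp_minus)
        moreover have "h t = rcis (cmod (h t)) (a0 - d * y s)"
          using h_step_rcis[OF s(3)] t by simp
        ultimately show ?thesis
          by (metis rcis_mult add.commute add_uminus_conv_diff)
      qed
      ultimately have "rcis r (\<alpha> s) * (- of_nat d * h t / (1 + h t)) =
          rcis (r * (d * cmod (h t) / exp (Re (z t)))) (\<alpha> s + (a0 - d * y s - pi - y t))"
        by (simp only: rcis_mult rcis_divide)
      moreover have "\<alpha> s + (a0 - d * y s - pi - y t) = \<alpha> t"
        using \<alpha>_step[OF s(3)] t by simp
      ultimately show ?thesis by simp
    qed
    moreover have "0 \<le> r * (d * cmod (h t) / exp (Re (z t)))" using r by simp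
    ultimately show ?case by metis
  qed
  moreover have "real (nat \<lfloor>t\<rfloor>) < t"
  proof -
    have "of_int \<lfloor>t\<rfloor> \<noteq> t" using assms by (metis Ints_of_int)
    then show ?thesis using assms of_int_floor_le[of t] by (simp add: less_le)
  qed
  moreover have "t < real (nat \<lfloor>t\<rfloor>) + 1" using assms by linarith
  ultimately show ?thesis by blast
qed

text \<open>The velocity component normal to direction \<open>b\<close>: \<open>b = 0\<close> gives
  the growth of the height, \<open>b = \<alpha> s\<close> the motion across the tangent at
  \<open>z s\<close>.\<close>

lemma Im_rotated_has_derivative:
  assumes "0 < t" "t \<notin> \<int>"
  shows "\<exists>r\<ge>0. ((\<lambda>t. Im (z t * cis (- b))) has_real_derivative r * sin (\<alpha> t - b)) (at t)"
proof -
  obtain r where r: "r \<ge> 0" "(z has_vector_derivative rcis r (\<alpha> t)) (at t)"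
    using z_has_vector_derivative[OF assms] by auto
  have "((\<lambda>t. z t * cis (- b)) has_vector_derivative rcis r (\<alpha> t) * cis (- b)) (at t)"
    using r(2) by (rule has_vector_derivative_mult_left)
  then have "((\<lambda>t. Im (z t * cis (- b))) has_vector_derivative Im (rcis r (\<alpha> t) * cis (- b))) (at t)"
    by (rule bounded_linear.has_vector_derivative[OF bounded_linear_Im])
  moreover have "Im (rcis r (\<alpha> t) * cis (- b)) = r * sin (\<alpha> t - b)"
    by (simp add: rcis_def cis_mult mult.assoc)
  ultimately show ?thesis
    using r(1) by (auto simp: has_real_derivative_iff_has_vector_derivative)
qed

section \<open>An invariant convex region\<close>

text \<open>On \<open>J\<close>, the initial stretch of times with \<open>\<alpha> > 0\<close>, the curve \<open>z\<close> is the graph of a convex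
  function of the height \<open>y\<close>. The region \<open>K\<close> to the right of this graph is given by the tangents.\<close>

definition J :: "real set" where
  "J = {t. 0 \<le> t \<and> (\<forall>s. 0 \<le> s \<longrightarrow> s \<le> t \<longrightarrow> 0 < \<alpha> s)}"

definition Y :: real where
  "Y = Sup (y ` J)"

definition K :: "complex set" where
  "K = {w. 0 \<le> Im w \<and> Im w \<le> Y \<and> (\<forall>s\<in>J. Im ((w - z s) * cis (- \<alpha> s)) \<le> 0)}"

lemma J_downward: "\<lbrakk>t \<in> J; 0 \<le> s; s \<le> t\<rbrakk> \<Longrightarrow> s \<in> J"
  by (auto simp: J_def)

lemma \<alpha>_J: "t \<in> J \<Longrightarrow> 0 < \<alpha> t" "t \<in> J \<Longrightarrow> \<alpha> t < pi"
  using \<alpha>_le[of t] a0 by (auto simp: J_def)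

section \<open>Monotonicity and convexity of the curve over \<open>J\<close>\<close>

lemma unit_subset_J: "{0..<1} \<subseteq> J"
proof -
  have "0 < \<alpha> s" if "0 \<le> s" "s < 1" for s
  proof -
    have "\<theta> s = a0" using that by (simp add: \<theta>_def z_neg)
    then have "y s < a0"
      using Im_Ln_one_plus_rcis_less[of "cmod (h s)" a0] h_rcis[of s] that a0 by (simp add: z_def)
    then show ?thesis using that by (simp add: \<alpha>_unit)
  qed
  then show ?thesis by (auto simp: J_def)
qed

lemma zero_in_J: "0 \<in> J"
  using unit_subset_J by auto

lemma finite_Ints_atLeastAtMost: "finite (\<int> \<inter> {a..b::real})"
  using finite_int_segment[of a b] by (simp add: Int_def)

lemma y_mono:
  assumes "t \<in> J" "s \<le> t"
  shows "y s \<le> y t"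
proof (cases "s \<le> 0")
  case True
  then show ?thesis using z_neg[OF True] y_nonneg[of t] by simp
next
  case False
  have "- y t \<le> - y s"
  proof (rule le_if_deriv_nonpos_at_records[OF assms(2) finite_Ints_atLeastAtMost[of s t]])
    show "continuous_on {s..t} (\<lambda>t. - y t)"
      by (intro continuous_intros continuous_on_z)
    fix v assume v: "s < v" "v < t" "v \<notin> \<int> \<inter> {s..t}"
    then have vJ: "v \<in> J" using False J_downward[OF assms(1)] by auto
    obtain r where r: "r \<ge> 0" "(y has_real_derivative r * sin (\<alpha> v)) (at v)"
      using Im_rotated_has_derivative[of v 0] v False by auto
    have "((\<lambda>t. - y t) has_real_derivative - (r * sin (\<alpha> v))) (at v)"
      using r(2) by (rule DERIV_minus)
    moreover have "0 \<le> r * sin (\<alpha> v)"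
      using r(1) \<alpha>_J[OF vJ] by (intro mult_nonneg_nonneg sin_ge_zero) auto
    ultimately show "\<exists>D\<le>0. ((\<lambda>t. - y t) has_real_derivative D) (at v)"
      by (intro exI[of _ "- (r * sin (\<alpha> v))"]) auto
  qed
  then show ?thesis by simp
qed

lemma y_mono_before:
  assumes "t \<in> J" "s \<le> u" "u \<le> t"
  shows "y s \<le> y u"
proof (cases "0 \<le> u")
  case True
  then show ?thesis using y_mono[OF J_downward[OF assms(1)]] assms by simp
next
  case False
  then show ?thesis using assms by (simp add: z_neg)
qed

lemma y_le_div: "y t \<le> a0 / d"
  using y_le[of t] d_pos by (simp add: field_simps)

lemma y_J_bdd_above: "bdd_above (y ` J)"
  using y_le_div by (auto intro!: bdd_aboveI[of _ "a0 / d"])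

lemma y_le_Y: "t \<in> J \<Longrightarrow> y t \<le> Y"
  unfolding Y_def by (intro cSup_upper y_J_bdd_above) auto

lemma Y_le: "Y \<le> a0 / d"
  unfolding Y_def using zero_in_J y_le_div by (intro cSup_least) auto

text \<open>The inequality is strict because the supremum \<open>Y\<close> may fail to be attained
  on \<open>J\<close>.\<close>

lemma y_J_surj:
  assumes "0 \<le> u" "u < Y"
  shows "\<exists>t\<in>J. y t = u"
proof -
  obtain j where j: "j \<in> J" "u < y j"
    using assms less_cSup_iff[of "y ` J" u] zero_in_J y_J_bdd_above by (auto simp: Y_def)
  have "\<exists>x\<ge>0. x \<le> j \<and> y x = u"
    using j assms by (intro IVT' continuous_intros continuous_on_z) (auto simp: z_neg J_def)
  then show ?thesis using J_downward[OF j(1)] by blast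
qed

lemma Y_pos: "0 < Y"
proof -
  have "0 < y (1/2)"
    using Im_Ln_pos_lt_imp[of "1 + h (1/2)"] Im_lam by (simp add: z_def h_unit)
  also have "\<dots> \<le> Y" using unit_subset_J by (intro y_le_Y) auto
  finally show ?thesis .
qed

text \<open>Over \<open>J\<close> the direction \<open>\<alpha>\<close> decreases between
  \<open>pi\<close> and 0, so the signed distance from the tangent at \<open>z s\<close> grows up to
  time \<open>s\<close> and falls afterwards.\<close>

lemma tangent:
  assumes s: "s \<in> J" and t: "t \<in> J"
  shows "Im ((z t - z s) * cis (- \<alpha> s)) \<le> 0"
proof -
  let ?F = "\<lambda>t. Im (z t * cis (- \<alpha> s))"
  have cont: "continuous_on A ?F" for A
    by (intro continuous_intros continuous_on_z)
  have \<alpha>_mono: "\<alpha> v \<le> \<alpha> u" if "v \<in> J" "u \<le> v" for u v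
    by (rule \<alpha>_antimono) (use that in \<open>auto intro: y_mono_before\<close>)
  have "?F t \<le> ?F s"
  proof (cases "s \<le> t")
    case True
    show ?thesis
    proof (rule le_if_deriv_nonpos_at_records[OF True finite_Ints_atLeastAtMost[of s t] cont])
      fix v assume v: "s < v" "v < t" "v \<notin> \<int> \<inter> {s..t}"
      then have vJ: "v \<in> J" and v0: "0 < v" using s J_downward[OF t] by (auto simp: J_def)
      obtain r where r: "r \<ge> 0" "(?F has_real_derivative r * sin (\<alpha> v - \<alpha> s)) (at v)"
        using Im_rotated_has_derivative[of v "\<alpha> s"] v v0 by auto
      have "0 \<le> sin (\<alpha> s - \<alpha> v)"
        using \<alpha>_mono[OF vJ, of s] v \<alpha>_J[OF vJ] \<alpha>_J[OF s] by (intro sin_ge_zero) auto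
      then have "sin (\<alpha> v - \<alpha> s) \<le> 0" by (simp add: sin_diff mult.commute)
      then show "\<exists>D\<le>0. (?F has_real_derivative D) (at v)"
        using r by (meson mult_nonneg_nonpos)
    qed
  next
    case False
    then have "t \<le> s" by simp
    have "- ?F s \<le> - ?F t"
    proof (rule le_if_deriv_nonpos_at_records[OF \<open>t \<le> s\<close> finite_Ints_atLeastAtMost[of t s]])
      show "continuous_on {t..s} (\<lambda>t. - ?F t)" by (intro continuous_intros cont)
      fix v assume v: "t < v" "v < s" "v \<notin> \<int> \<inter> {t..s}"
      then have vJ: "v \<in> J" and v0: "0 < v" using t J_downward[OF s] by (auto simp: J_def)
      obtain r where r: "r \<ge> 0" "(?F has_real_derivative r * sin (\<alpha> v - \<alpha> s)) (at v)"
        using Im_rotated_has_derivative[of v "\<alpha> s"] v v0 by auto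
      have "0 \<le> sin (\<alpha> v - \<alpha> s)"
        using \<alpha>_mono[OF s, of v] v \<alpha>_J[OF vJ] \<alpha>_J[OF s] by (intro sin_ge_zero) auto
      then have "- (r * sin (\<alpha> v - \<alpha> s)) \<le> 0" using r by simp
      moreover have "((\<lambda>t. - ?F t) has_real_derivative - (r * sin (\<alpha> v - \<alpha> s))) (at v)"
        using r(2) by (rule DERIV_minus)
      ultimately show "\<exists>D\<le>0. ((\<lambda>t. - ?F t) has_real_derivative D) (at v)" by blast
    qed
    then show ?thesis by simp
  qed
  then show ?thesis by (simp add: left_diff_distrib)
qed

text \<open>Past \<open>J\<close> the curve does not climb again: at a time \<open>v\<close> of record height all summands of \<open>\<alpha>\<close>
  have grown since a time where \<open>\<alpha> \<le> 0\<close>, hence \<open>\<alpha> v \<le> 0\<close> as well.\<close>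

lemma y_step_le_Y:
  assumes t: "t \<in> J"
  shows "y (t + 1) \<le> Y"
proof (cases "t + 1 \<in> J")
  case True
  then show ?thesis by (rule y_le_Y)
next
  case False
  have t0: "0 \<le> t" using t by (simp add: J_def)
  define A where "A = {a. 0 \<le> a \<and> a \<le> t + 1 \<and> \<alpha> a \<le> 0}"
  have "A \<noteq> {}" using False t0 by (auto simp: J_def A_def not_less)
  have "bdd_below A" by (auto simp: A_def intro: bdd_belowI[of _ 0])
  have le_A: "y (t + 1) \<le> y a" if a: "a \<in> A" for a
  proof -
    have a': "0 \<le> a" "a \<le> t + 1" "\<alpha> a \<le> 0" using a by (auto simp: A_def)
    have "a \<notin> J" using a' by (auto simp: J_def not_less)
    then have a1: "1 \<le> a" using unit_subset_J a' by (auto simp: not_less[symmetric])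
    show ?thesis
    proof (rule le_if_deriv_nonpos_at_records[OF a'(2) finite_Ints_atLeastAtMost[of a "t + 1"]])
      show "continuous_on {a..t + 1} y" by (intro continuous_intros continuous_on_z)
      fix v assume v: "a < v" "v < t + 1" "v \<notin> \<int> \<inter> {a..t + 1}"
        and rec_v: "\<And>x. \<lbrakk>a \<le> x; x \<le> v\<rbrakk> \<Longrightarrow> y x \<le> y v"
      \<comment> \<open>The sum in \<open>\<alpha> v\<close> looks back at least one unit, to times
        where \<open>y\<close> is monotone; the record property handles the remaining term
        \<open>y v\<close>.\<close>
      have vJ: "v - 1 \<in> J" using J_downward[OF t, of "v - 1"] v a1 by auto
      have "\<alpha> v \<le> \<alpha> a"
      proof (rule \<alpha>_antimono)
        fix k :: nat assume k: "1 \<le> k"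
        then show "y (a - real k) \<le> y (v - real k)"
          by (intro y_mono_before[OF vJ]) (use v in auto)
      qed (use v rec_v in auto)
      then have le0: "\<alpha> v \<le> 0" using a' by simp
      \<comment> \<open>The sign of \<open>sin (\<alpha> v)\<close> also needs a lower bound: since
        time \<open>v - 1\<close> the angle has dropped by at most \<open>pi\<close>.\<close>
      have "\<alpha> v = \<alpha> (v - 1) + \<theta> v - y v - pi"
        using \<alpha>_step[of "v - 1"] v a1 by (simp add: \<theta>_def)
      moreover have "y v \<le> \<theta> v" using y_le_\<theta>[of v] v a1 by simp
      ultimately have "- pi < \<alpha> v" using \<alpha>_J(1)[OF vJ] by linarith
      then have "0 \<le> sin (- \<alpha> v)" using le0 by (intro sin_ge_zero) auto
      then have sin: "sin (\<alpha> v) \<le> 0" by simp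
      obtain r where "r \<ge> 0" "(y has_real_derivative r * sin (\<alpha> v)) (at v)"
        using Im_rotated_has_derivative[of v 0] v a1 by auto
      then show "\<exists>D\<le>0. (y has_real_derivative D) (at v)"
        using sin by (intro exI[of _ "r * sin (\<alpha> v)"]) (auto simp: mult_nonneg_nonpos)
    qed
  qed
  \<comment> \<open>As \<open>\<alpha>\<close> may jump, \<open>p\<close> is not shown to lie in
    \<open>A\<close>; continuity of \<open>y\<close> carries the bound to the closure, and all
    nonnegative times before \<open>p\<close> belong to \<open>J\<close>.\<close>
  define p where "p = Inf A"
  have "p \<in> closure A"
    unfolding p_def by (rule closure_contains_Inf[OF \<open>A \<noteq> {}\<close> \<open>bdd_below A\<close>])
  moreover have "closure A \<subseteq> {a. y (t + 1) \<le> y a}"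
    by (intro closure_minimal closed_Collect_le continuous_intros continuous_on_z) (use le_A in auto)
  ultimately have "y (t + 1) \<le> y p" by auto
  also have "y p \<le> Y"
  proof (cases "p \<le> 0")
    case True
    then show ?thesis using Y_pos by (simp add: z_neg)
  next
    case False
    have "p \<le> t + 1"
      using \<open>A \<noteq> {}\<close> cInf_lower[OF _ \<open>bdd_below A\<close>] by (fastforce simp: p_def A_def)
    then have "x \<in> J" if "0 \<le> x" "x < p" for x
      using that cInf_lower[OF _ \<open>bdd_below A\<close>] by (force simp: p_def A_def J_def not_le[symmetric])
    then have "closure {0..<p} \<subseteq> {x. y x \<le> Y}"
      by (intro closure_minimal closed_Collect_le continuous_intros continuous_on_z) (auto intro: y_le_Y)
    then have "{0..p} \<subseteq> {x. y x \<le> Y}" using False by simp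
    then show ?thesis using False by (auto dest!: subsetD[where c = p])
  qed
  finally show ?thesis .
qed

section \<open>Convexity, closedness and horizontal slices of \<open>K\<close>\<close>

lemma convex_K: "convex K"
proof (rule convexI)
  fix v w and a b :: real
  assume vw: "v \<in> K" "w \<in> K" and ab: "0 \<le> a" "0 \<le> b" "a + b = 1"
  have "Im ((a *\<^sub>R v + b *\<^sub>R w - z s) * cis (- \<alpha> s)) \<le> 0" if "s \<in> J" for s
  proof -
    have b: "b = 1 - a" using ab by simp
    have "Im ((a *\<^sub>R v + b *\<^sub>R w - z s) * cis (- \<alpha> s))
        = a * Im ((v - z s) * cis (- \<alpha> s)) + b * Im ((w - z s) * cis (- \<alpha> s))"
      unfolding b by (simp add: algebra_simps)
    also have "\<dots> \<le> 0"
      using vw that ab by (intro add_nonpos_nonpos mult_nonneg_nonpos) (auto simp: K_def)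
    finally show ?thesis .
  qed
  moreover have "a * Im v + b * Im w \<le> Y"
    using vw ab by (intro convex_bound_le) (auto simp: K_def)
  ultimately show "a *\<^sub>R v + b *\<^sub>R w \<in> K"
    using vw ab by (auto simp: K_def)
qed

lemma closed_K: "closed K"
proof -
  have "K = {w. 0 \<le> Im w} \<inter> {w. Im w \<le> Y} \<inter> (\<Inter>s\<in>J. {w. Im ((w - z s) * cis (- \<alpha> s)) \<le> 0})"
    by (auto simp: K_def)
  also have "closed \<dots>"
    by (intro closed_Int closed_INT ballI closed_Collect_le continuous_intros)
  finally show ?thesis .
qed

text \<open>Moving right lowers every tangent expression because \<open>sin (\<alpha> s)\<close> is
  positive. Together with \<open>in_K_right_of_curve\<close>, the slice of \<open>K\<close> at a
  height attained on \<open>J\<close> is a ray that starts on the curve.\<close>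

lemma right_of_curve_in_K:
  assumes t: "t \<in> J" and "Im w = y t" "Re (z t) \<le> Re w"
  shows "w \<in> K"
proof -
  have w: "w = z t + of_real (Re w - Re (z t))"
    using assms by (simp add: complex_eq_iff)
  have "Im ((w - z s) * cis (- \<alpha> s)) \<le> 0" if s: "s \<in> J" for s
  proof -
    have "Im ((w - z s) * cis (- \<alpha> s))
        = Im ((z t - z s) * cis (- \<alpha> s)) - (Re w - Re (z t)) * sin (\<alpha> s)"
      by (subst w) (simp add: algebra_simps)
    also have "\<dots> \<le> 0"
    proof -
      have "0 \<le> (Re w - Re (z t)) * sin (\<alpha> s)"
        using assms \<alpha>_J[OF s] by (intro mult_nonneg_nonneg sin_ge_zero) auto
      then show ?thesis using tangent[OF s t] by linarith
    qed
    finally show ?thesis .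
  qed
  then show ?thesis using assms y_nonneg y_le_Y by (simp add: K_def)
qed

lemma zero_in_K: "0 \<in> K"
  using right_of_curve_in_K[OF zero_in_J, of 0] by (simp add: z_neg)

lemma in_K_right_of_curve:
  assumes "w \<in> K" "t \<in> J" "Im w = y t"
  shows "Re (z t) \<le> Re w"
proof -
  have "w - z t = of_real (Re w - Re (z t))" using assms by (simp add: complex_eq_iff)
  then have "Im ((w - z t) * cis (- \<alpha> t)) = - ((Re w - Re (z t)) * sin (\<alpha> t))" by simp
  then have "0 \<le> (Re w - Re (z t)) * sin (\<alpha> t)" using assms by (auto simp: K_def)
  then show ?thesis using \<alpha>_J[OF assms(2)] sin_gt_zero[of "\<alpha> t"] by (simp add: zero_le_mult_iff)
qed

lemma K_Im: "w \<in> K \<Longrightarrow> 0 \<le> Im w" "w \<in> K \<Longrightarrow> d * Im w \<le> a0"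
proof -
  show "w \<in> K \<Longrightarrow> 0 \<le> Im w" by (simp add: K_def)
  assume "w \<in> K"
  then have "Im w \<le> a0 / d" using Y_le by (auto simp: K_def)
  then show "d * Im w \<le> a0" using d_pos by (simp add: field_simps)
qed

section \<open>Invariance of \<open>K\<close> under \<open>\<phi>\<close>\<close>

definition \<phi> :: "complex \<Rightarrow> complex" where
  "\<phi> w = Ln (1 + lam * exp (- (of_nat d * w)))"

lemma exp_\<phi>: "w \<in> K \<Longrightarrow> exp (\<phi> w) = 1 + lam * exp (- (of_nat d * w))"
  unfolding \<phi>_def
  by (rule exp_Ln) (metis lam_exp_notin_nonpos_Reals K_Im nonpos_Reals_zero_I)

text \<open>The shift by \<open>x\<close> keeps the argument \<open>\<eta>\<close> of
  \<open>h (t + 1)\<close> and shrinks its modulus, so for positive \<open>\<eta>\<close> the image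
  sinks strictly below \<open>z (t + 1)\<close>. The curve has that height at some
  \<open>s \<le> t + 1\<close>, where the argument \<open>\<theta> s\<close> is at least
  \<open>\<eta>\<close>; hence \<open>z s\<close> is not to the right of the image.\<close>

lemma \<phi>_right_of_curve:
  assumes t: "t \<in> J" and "0 < x"
  shows "\<phi> (z t + of_real x) \<in> K"
proof -
  have t0: "0 \<le> t" using t by (simp add: J_def)
  define \<eta> where "\<eta> = \<theta> (t + 1)"
  define r where "r = cmod (h (t + 1)) * exp (- (d * x))"
  define w where "w = \<phi> (z t + of_real x)"
  have h': "h (t + 1) = rcis (cmod (h (t + 1))) \<eta>"
    using h_rcis[of "t + 1"] t0 by (simp add: \<eta>_def)
  have "h (t + 1) \<noteq> 0" using h_step_exp[OF t0] lam_nz by simp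
  moreover have "exp (- (d * x)) < 1" using d_pos \<open>0 < x\<close> by simp
  ultimately have r: "0 \<le> r" "r < cmod (h (t + 1))" by (auto simp: r_def)
  have "lam * exp (- (of_nat d * (z t + of_real x))) = h (t + 1) * of_real (exp (- (d * x)))"
    using h_step_exp[OF t0] by (simp add: algebra_simps exp_add exp_diff exp_minus divide_inverse exp_of_real[symmetric])
  also have "\<dots> = rcis r \<eta>" by (subst h') (simp add: r_def rcis_def mult_ac)
  finally have w: "w = Ln (1 + rcis r \<eta>)" by (simp add: w_def \<phi>_def)
  have \<eta>: "0 \<le> \<eta>" "\<eta> < pi" using \<theta>_bounds by (auto simp: \<eta>_def)
  have "w \<in> K"
  proof (cases "\<eta> = 0")
    case True
    \<comment> \<open>The image is a nonnegative real number, so it lies on the ray to the right of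
      \<open>z 0 = 0\<close>.\<close>
    then have "w = of_real (ln (1 + r))"
      using r by (simp add: w rcis_def Ln_of_real[symmetric])
    then show ?thesis using right_of_curve_in_K[OF zero_in_J, of w] r by (simp add: z_neg)
  next
    case False
    then have "0 < \<eta>" using \<eta> by simp
    have w0: "0 \<le> Im w" using Ln_one_plus_rcis_sines(3)[OF r(1) \<eta>] by (simp add: w)
    have less: "Im w < y (t + 1)"
      using Im_Ln_one_plus_rcis_strict_mono[OF r \<open>0 < \<eta>\<close> \<eta>(2)] h' by (simp add: w z_def)
    then have "Im w < Y" using y_step_le_Y[OF t] by simp
    then obtain s where s: "s \<in> J" "y s = Im w" using y_J_surj[OF w0] by auto
    then have s0: "0 \<le> s" by (simp add: J_def)
    have "s \<le> t + 1" using y_mono[OF s(1), of "t + 1"] s less by (cases "s \<le> t + 1") auto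
    then have "\<eta> \<le> \<theta> s"
      using y_mono[OF t, of "s - 1"] by (simp add: \<eta>_def \<theta>_def mult_left_mono)
    then have "Re (z s) \<le> Re w"
      using Re_Ln_one_plus_rcis_le[of r "cmod (h s)" \<eta> "\<theta> s"] r \<open>0 < \<eta>\<close> \<theta>_bounds s(2)
        h_rcis[OF s0] by (simp add: w z_def)
    then show ?thesis using right_of_curve_in_K[OF s(1)] s by simp
  qed
  then show ?thesis by (simp add: w_def)
qed

lemma \<phi>_K:
  assumes w: "w \<in> K"
  shows "\<phi> w \<in> K"
proof -
  define e where "e n = inverse (real (Suc n))" for n
  \<comment> \<open>Scaling towards 0 brings the height strictly below \<open>Y\<close>, so that the
    curve attains it; adding \<open>e n\<close> moves the point strictly to the right of the curve.
    Closedness of \<open>K\<close> then handles the limit.\<close>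
  define v where "v n = (1 - e n) *\<^sub>R w + of_real (e n)" for n
  have e: "e \<longlonglongrightarrow> 0" "0 < e n" "e n \<le> 1" for n
    unfolding e_def by (rule LIMSEQ_inverse_real_of_nat) (auto simp: field_simps)
  have "\<phi> (v n) \<in> K" for n
  proof -
    define u where "u = (1 - e n) *\<^sub>R w"
    have "(1 - e n) *\<^sub>R w + e n *\<^sub>R 0 \<in> K"
      using e w zero_in_K by (intro convexD[OF convex_K]) (auto simp: less_imp_le)
    then have u: "u \<in> K" by (simp add: u_def)
    have "(1 - e n) * Im w \<le> (1 - e n) * Y"
      using w e by (intro mult_left_mono) (auto simp: K_def)
    also have "\<dots> < Y" using e(2)[of n] Y_pos by (simp add: algebra_simps)
    finally obtain t where t: "t \<in> J" "y t = Im u"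
      using y_J_surj[of "Im u"] K_Im(1)[OF u] by (auto simp: u_def)
    have "Re (z t) \<le> Re u" using in_K_right_of_curve[OF u t(1)] t by simp
    moreover have "v n = z t + of_real (Re u - Re (z t) + e n)"
      using t by (simp add: v_def u_def[symmetric] complex_eq_iff)
    ultimately show ?thesis
      using \<phi>_right_of_curve[OF t(1), of "Re u - Re (z t) + e n"] e(2)[of n] by simp
  qed
  moreover have "(\<lambda>n. \<phi> (v n)) \<longlonglongrightarrow> \<phi> w"
  proof -
    have "(\<lambda>n. (1 - e n) *\<^sub>R w + of_real (e n)) \<longlonglongrightarrow> (1 - 0) *\<^sub>R w + of_real 0"
      by (intro tendsto_intros e)
    then have "v \<longlonglongrightarrow> w" by (simp add: v_def[abs_def])
    then show ?thesis
      unfolding \<phi>_def using lam_exp_notin_nonpos_Reals[OF K_Im[OF w]]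
      by (intro tendsto_intros) auto
  qed
  ultimately show ?thesis using closed_sequentially[OF closed_K, of "\<lambda>n. \<phi> (v n)" "\<phi> w"] by blast
qed

end

section \<open>The independence polynomial on vertex subsets\<close>

text \<open>The edge relation stays fixed while the vertex set shrinks, so deletions need no
  subgraphs.\<close>

definition indep_poly_on :: "('a \<times> 'a) set \<Rightarrow> 'a set \<Rightarrow> complex \<Rightarrow> complex" where
  "indep_poly_on E U x = (\<Sum>I | I \<subseteq> U \<and> (\<forall>u\<in>I. \<forall>v\<in>I. (u, v) \<notin> E). x ^ card I)"

lemma indep_poly_on_empty [simp]: "indep_poly_on E {} x = 1"
proof -
  have "{I. I \<subseteq> {} \<and> (\<forall>u\<in>I. \<forall>v\<in>I. (u, v) \<notin> E)} = {{}}" by auto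
  then show ?thesis by (simp add: indep_poly_on_def)
qed

lemma indep_poly_on_delete_vertex:
  assumes "finite U" "v \<in> U" "sym E" "(v, v) \<notin> E"
  shows "indep_poly_on E U x
    = indep_poly_on E (U - {v}) x + x * indep_poly_on E (U - {v} - {u. (v, u) \<in> E}) x"
proof -
  define F where "F W = {I. I \<subseteq> W \<and> (\<forall>u\<in>I. \<forall>v\<in>I. (u, v) \<notin> E)}" for W
  let ?W = "U - {v} - {u. (v, u) \<in> E}"
  have F_split: "F U = F (U - {v}) \<union> insert v ` F ?W"
  proof (intro equalityI subsetI)
    fix I assume I: "I \<in> F U"
    show "I \<in> F (U - {v}) \<union> insert v ` F ?W"
    proof (cases "v \<in> I")
      case True
      then have "I = insert v (I - {v})" "I - {v} \<in> F ?W" using I by (auto simp: F_def)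
      then show ?thesis by blast
    qed (use I in \<open>auto simp: F_def\<close>)
  next
    fix I assume "I \<in> F (U - {v}) \<union> insert v ` F ?W"
    then show "I \<in> F U" using assms by (auto simp: F_def dest: symD)
  qed
  have fin: "finite (F W)" if "W \<subseteq> U" for W
    by (rule finite_subset[of _ "Pow U"]) (use that assms in \<open>auto simp: F_def\<close>)
  have inj: "inj_on (insert v) (F ?W)"
    by (rule inj_onI) (auto simp: F_def dest!: insert_ident[THEN iffD1, rotated 2])
  have "(\<Sum>I\<in>insert v ` F ?W. x ^ card I) = (\<Sum>I\<in>F ?W. x * x ^ card I)"
    unfolding sum.reindex[OF inj] o_def
  proof (rule sum.cong)
    fix I assume "I \<in> F ?W"
    then have "finite I" "v \<notin> I" using assms(1) by (auto simp: F_def intro: finite_subset)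
    then show "x ^ card (insert v I) = x * x ^ card I" by simp
  qed simp
  moreover have "(\<Sum>I\<in>F U. x ^ card I)
      = (\<Sum>I\<in>F (U - {v}). x ^ card I) + (\<Sum>I\<in>insert v ` F ?W. x ^ card I)"
    unfolding F_split by (intro sum.union_disjoint fin finite_imageI) (auto simp: F_def)
  ultimately show ?thesis
    by (simp add: indep_poly_on_def F_def sum_distrib_left)
qed

section \<open>Ratios of polynomials as exponentials of points of \<open>K\<close>\<close>

context upper_h_curve
begin

text \<open>The point \<open>w\<close> is the mean of \<open>d\<close> points of \<open>K\<close>:
  the values of \<open>f\<close>, padded with copies of 0.\<close>

lemma sum_of_K:
  assumes "finite A" "card A \<le> d" "\<And>a. a \<in> A \<Longrightarrow> f a \<in> K"
  shows "\<exists>w\<in>K. (\<Sum>a\<in>A. f a) = of_nat d * w"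
proof -
  define w where "w = (\<Sum>a\<in>A. f a) / of_nat d"
  have "w \<in> K"
  proof (cases "A = {}")
    case True
    then show ?thesis by (simp add: w_def zero_in_K)
  next
    case False
    then have "0 < card A" using assms(1) by (simp add: card_gt_0_iff)
    define m where "m = (\<Sum>a\<in>A. (1 / card A) *\<^sub>R f a)"
    have "m \<in> K"
      unfolding m_def using assms False \<open>0 < card A\<close>
      by (intro convex_sum[OF _ convex_K]) auto
    then have "(card A / d) *\<^sub>R m + (1 - card A / d) *\<^sub>R 0 \<in> K"
      using assms(2) d_pos zero_in_K by (intro convexD[OF convex_K]) auto
    moreover have "(card A / d) *\<^sub>R m = w"
      using \<open>0 < card A\<close> by (simp add: m_def w_def scaleR_conv_of_real sum_distrib_left[symmetric] sum_divide_distrib[symmetric])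
    ultimately show ?thesis by simp
  qed
  moreover have "(\<Sum>a\<in>A. f a) = of_nat d * w" using d_pos by (simp add: w_def)
  ultimately show ?thesis by blast
qed

text \<open>Telescoping over single deletions; \<open>step\<close> is asked for all subsets
  \<open>V\<close> of \<open>W\<close> because it is applied to the intermediate vertex
  sets.\<close>

lemma indep_poly_on_delete_set:
  assumes "A \<subseteq> W" "finite W"
    and step: "\<And>V u. \<lbrakk>V \<subseteq> W; u \<in> V; u \<in> A\<rbrakk>
      \<Longrightarrow> \<exists>w\<in>K. indep_poly_on E V lam = indep_poly_on E (V - {u}) lam * exp w"
  shows "\<exists>f. (\<forall>a\<in>A. f a \<in> K) \<and>
    indep_poly_on E W lam = indep_poly_on E (W - A) lam * exp (\<Sum>a\<in>A. f a)"
proof -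
  have "finite A" using assms(1,2) by (rule finite_subset)
  then show ?thesis using assms(1) step
  proof (induction A)
    case empty
    then show ?case by simp
  next
    case (insert u A)
    then obtain f where f: "\<forall>a\<in>A. f a \<in> K"
        "indep_poly_on E W lam = indep_poly_on E (W - A) lam * exp (\<Sum>a\<in>A. f a)"
      by auto
    obtain w where w: "w \<in> K"
        "indep_poly_on E (W - A) lam = indep_poly_on E (W - A - {u}) lam * exp w"
      using insert.prems(2)[of "W - A" u] insert.prems(1) insert.hyps by auto
    have "W - A - {u} = W - insert u A" by auto
    moreover have "(\<Sum>a\<in>A. (f(u := w)) a) = (\<Sum>a\<in>A. f a)"
      using insert.hyps by (intro sum.cong) auto
    ultimately have "indep_poly_on E W lam
        = indep_poly_on E (W - insert u A) lam * exp (\<Sum>a\<in>insert u A. (f(u := w)) a)"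
      using f(2) w(2) insert.hyps by (simp add: exp_add)
    then show ?case using f(1) w(1) by (intro exI[of _ "f(u := w)"]) auto
  qed
qed

text \<open>The ratio claim is limited to degree at most \<open>d\<close>, where the logarithms
  average to a point of \<open>K\<close>. This suffices for the recursion, as deleting
  \<open>v\<close> lowers the degree of each neighbour to at most \<open>d\<close>. Nonvanishing
  must also treat degree \<open>d + 1\<close>.\<close>

lemma indep_poly_on_ratio_in_K:
  assumes "finite U" and E: "sym E" "irrefl E"
    and "\<And>v. v \<in> U \<Longrightarrow> card {u \<in> U. (v, u) \<in> E} \<le> d + 1"
  shows "indep_poly_on E U lam \<noteq> 0 \<and>
    (\<forall>v\<in>U. card {u \<in> U. (v, u) \<in> E} \<le> d \<longrightarrow>
      (\<exists>w\<in>K. indep_poly_on E U lam = indep_poly_on E (U - {v}) lam * exp w))"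
  using assms(1,4)
proof (induction "card U" arbitrary: U rule: less_induct)
  case less
  let ?Z = "\<lambda>U. indep_poly_on E U lam"
  let ?N = "\<lambda>v. {u \<in> U. (v, u) \<in> E}"
  have smaller: "?Z V \<noteq> 0 \<and> (\<forall>u\<in>V. card {x \<in> V. (u, x) \<in> E} \<le> d \<longrightarrow>
      (\<exists>w\<in>K. ?Z V = ?Z (V - {u}) * exp w))" if "V \<subset> U" for V
  proof (rule less.hyps)
    show "card V < card U" "finite V"
      using that less.prems(1) by (auto intro: psubset_card_mono finite_subset)
    fix v assume "v \<in> V"
    have "card {u \<in> V. (v, u) \<in> E} \<le> card (?N v)"
      using that less.prems(1) by (intro card_mono) auto
    also have "\<dots> \<le> d + 1" using less.prems(2) that \<open>v \<in> V\<close> by auto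
    finally show "card {u \<in> V. (v, u) \<in> E} \<le> d + 1" .
  qed
  have expand: "\<exists>f. (\<forall>a\<in>?N v. f a \<in> K) \<and>
      ?Z U = ?Z (U - {v} - ?N v) * (exp (\<Sum>a\<in>?N v. f a) + lam) \<and>
      ?Z (U - {v}) = ?Z (U - {v} - ?N v) * exp (\<Sum>a\<in>?N v. f a)"
    if v: "v \<in> U" for v
  proof -
    have vv: "(v, v) \<notin> E" using E by (auto simp: irrefl_def)
    have "\<exists>f. (\<forall>a\<in>?N v. f a \<in> K) \<and>
        ?Z (U - {v}) = ?Z (U - {v} - ?N v) * exp (\<Sum>a\<in>?N v. f a)"
    proof (rule indep_poly_on_delete_set)
      show "?N v \<subseteq> U - {v}" using vv by auto
      show "finite (U - {v})" using less.prems by simp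
      fix V u assume V: "V \<subseteq> U - {v}" "u \<in> V" "u \<in> ?N v"
      \<comment> \<open>The inclusion is strict because the neighbour \<open>v\<close> of
        \<open>u\<close> has been deleted.\<close>
      have "{x \<in> V. (u, x) \<in> E} \<subset> ?N u"
        using V v E by (auto dest: symD)
      then have "card {x \<in> V. (u, x) \<in> E} < card (?N u)"
        using less.prems(1) by (intro psubset_card_mono) auto
      also have "\<dots> \<le> d + 1" using less.prems(2) V by auto
      finally have "card {x \<in> V. (u, x) \<in> E} \<le> d" by simp
      then show "\<exists>w\<in>K. ?Z V = ?Z (V - {u}) * exp w"
        using smaller[of V] V v by blast
    qed
    moreover have "U - {v} - {u. (v, u) \<in> E} = U - {v} - ?N v" by auto
    ultimately show ?thesis
      using indep_poly_on_delete_vertex[OF less.prems(1) v E(1) vv, of lam]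
      by (auto simp: algebra_simps)
  qed
  have ratio: "\<exists>w\<in>K. ?Z U = ?Z (U - {v}) * exp w" if v: "v \<in> U" and deg: "card (?N v) \<le> d" for v
  proof -
    obtain f where f: "\<forall>a\<in>?N v. f a \<in> K"
        "?Z U = ?Z (U - {v} - ?N v) * (exp (\<Sum>a\<in>?N v. f a) + lam)"
        "?Z (U - {v}) = ?Z (U - {v} - ?N v) * exp (\<Sum>a\<in>?N v. f a)"
      using expand[OF v] by auto
    obtain w where w: "w \<in> K" "(\<Sum>a\<in>?N v. f a) = of_nat d * w"
      using sum_of_K[of "?N v" f] f(1) deg less.prems(1) by auto
    have "exp (of_nat d * w) + lam = exp (of_nat d * w) * exp (\<phi> w)"
      using exp_\<phi>[OF w(1)] by (simp add: exp_minus field_simps)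
    then have "?Z U = ?Z (U - {v}) * exp (\<phi> w)" using f w by simp
    then show ?thesis using \<phi>_K[OF w(1)] by blast
  qed
  have "?Z U \<noteq> 0"
  proof (cases "U = {}")
    case False
    then obtain v where v: "v \<in> U" by auto
    obtain f where f: "\<forall>a\<in>?N v. f a \<in> K"
        "?Z U = ?Z (U - {v} - ?N v) * (exp (\<Sum>a\<in>?N v. f a) + lam)"
      using expand[OF v] by auto
    have "?Z (U - {v} - ?N v) \<noteq> 0" using smaller[of "U - {v} - ?N v"] v by auto
    \<comment> \<open>With at most \<open>d + 1\<close> summands the imaginary part of the sum lies
      between 0 and \<open>2 * a0\<close>, hence less than \<open>pi\<close> away from
      \<open>a0\<close>; a zero would force the difference to be an odd multiple of
      \<open>pi\<close>.\<close>
    moreover have "exp (\<Sum>a\<in>?N v. f a) + lam \<noteq> 0"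
    proof
      let ?S = "\<Sum>a\<in>?N v. f a"
      assume "exp ?S + lam = 0"
      have bound: "0 \<le> Im (f a)" "Im (f a) \<le> a0 / d" if "a \<in> ?N v" for a
        using f(1) that K_Im[of "f a"] d_pos by (auto simp: field_simps)
      have "0 \<le> Im ?S" using bound by (auto simp: Im_sum intro: sum_nonneg)
      have "Im ?S \<le> (\<Sum>a\<in>?N v. a0 / d)" unfolding Im_sum by (intro sum_mono bound)
      also have "\<dots> \<le> (d + 1) * (a0 / d)"
        using mult_right_mono[of "real (card (?N v))" "real (d + 1)" "a0 / d"]
          less.prems(2)[OF v] a0 by simp
      also have "\<dots> = a0 + a0 / d" using d_pos by (simp add: field_simps)
      also have "\<dots> \<le> a0 + a0" using a0 d_pos by (simp add: field_simps)
      finally have small: "\<bar>Im ?S - a0\<bar> < pi" using \<open>0 \<le> Im ?S\<close> a0 by linarith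
      have "exp ?S = - rcis (cmod lam) a0"
        using \<open>exp ?S + lam = 0\<close> by (simp add: rcis_cmod_Arg eq_neg_iff_add_eq_0)
      then have "rcis (exp (Re ?S)) (Im ?S) * cis (- a0) = - rcis (cmod lam) a0 * cis (- a0)"
        by (simp only: exp_eq_polar rcis_def)
      then have "of_real (exp (Re ?S)) * cis (Im ?S - a0) = - of_real (cmod lam)"
        by (simp add: rcis_def cis_mult mult.assoc)
      then have "exp (Re ?S) * sin (Im ?S - a0) = 0"
          "exp (Re ?S) * cos (Im ?S - a0) = - cmod lam"
        by (auto simp: complex_eq_iff)
      moreover from this(1) small have "Im ?S - a0 = 0" by (simp add: sin_zero_pi_iff)
      ultimately have "exp (Re ?S) = - cmod lam" by simp
      then show False using norm_ge_zero[of lam] exp_gt_zero[of "Re ?S"] by linarith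
    qed
    ultimately show ?thesis using f(2) by simp
  qed simp
  then show ?case using ratio by blast
qed

end

theorem theorem4p6:
  fixes d :: nat and lam :: complex and G :: "('a, 'b) pre_digraph"
  assumes "d \<ge> 2"
    and "Im lam > 0"
    and "\<forall>t::real. t \<ge> 0 \<longrightarrow> (\<exists>w. h_curve d lam t = Some w \<and> Im w \<ge> 0)"
    and "G \<in> graphs_max_degree (d + 1)"
  shows "independence_polynomial G lam \<noteq> 0"
proof -
  interpret upper_h_curve d lam
    by unfold_locales (use assms in auto)
  interpret graph G using assms(4) by (simp add: graphs_max_degree_def)
  have "card {u \<in> verts G. (v, u) \<in> arcs_ends G} \<le> d + 1" if "v \<in> verts G" for v
  proof -
    have "{u \<in> verts G. (v, u) \<in> arcs_ends G} \<subseteq> head G ` out_arcs G v"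
      by (auto simp: arcs_ends_def arc_to_ends_def)
    then have "card {u \<in> verts G. (v, u) \<in> arcs_ends G} \<le> card (head G ` out_arcs G v)"
      by (intro card_mono) auto
    also have "\<dots> \<le> out_degree G v" unfolding out_degree_def by (intro card_image_le) auto
    finally show ?thesis using assms(4) that by (auto simp: graphs_max_degree_def)
  qed
  moreover have "sym (arcs_ends G)" using sym_arcs by (simp add: symmetric_def)
  moreover have "irrefl (arcs_ends G)"
    using no_loops by (auto simp: irrefl_def arcs_ends_def arc_to_ends_def)
  ultimately have "indep_poly_on (arcs_ends G) (verts G) lam \<noteq> 0"
    using indep_poly_on_ratio_in_K[of "verts G" "arcs_ends G"] by auto
  then show ?thesis
    by (simp add: indep_poly_on_def independence_polynomial_def independent_set_def)
qed

end
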